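(* Let the flavor indices $a,b,c,\dots$ and lattice sites $k,l,m,n,\dots$ all range over $\mathbb{Z}$, and let $\tilde d:\mathbb{Z}\to\mathbb{C}$ be an arbitrary function. Define $$C^{abc}_{lmn}=\delta_{l-n,b}\,\delta_{n-m,a}\,\delta_{c,a+b},\qquad D^{ac}_{mn}=\tilde d(a-c)\big(\delta_{m-n,a-c}-\delta_{m-n,-a+c}\big).$$ Then: (1) (translation invariance) $C^{abc}_{lmn}$ depends on $l,m,n$ only through $(l-n,m-n)$ and $D^{ac}_{mn}$ depends on $m,n$ only through $m-n$; (2) (locality) for all flavor indices the functions $\hat C^{abc}(v,w)=\sum_{k,l}C^{abc}_{kl0}v^kw^l=\delta_{a+b,c}\,v^bw^{-a}$ and $\hat D^{ac}(v)=\sum_m D^{ac}_{m0}v^m=\tilde d(a-c)(v^{a-c}-v^{-a+c})$ are holomorphic on an annular neighborhood of the unit circle in each variable; (3) (Leibniz rule) for all $a,b,c,l,m,n\in\mathbb{Z}$, $$\sum_{k}\sum_{d}C^{abd}_{lmk}D^{dc}_{kn}=\sum_k\sum_d C^{dbc}_{kmn}D^{ad}_{lk}+\sum_k\sum_d C^{adc}_{lkn}D^{bd}_{mk};$$ (4) (associative law) for all $a,b,c,e,l,m,n,k\in\mathbb{Z}$, $$\sum_j\sum_d C^{abd}_{lmj}C^{dce}_{jnk}=\sum_j\sum_d C^{ade}_{ljk}C^{bcd}_{mnj}.$$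
   Context: $\delta_{x,y}$ is the Kronecker delta; all sums run over $\mathbb{Z}$ and have only finitely many nonzero terms. The coefficients define, on lattice fields $\phi^a_n$ with infinitely many flavors, a product rule $(\phi\cdot\psi)^c_n=\sum_{l,m}\sum_{a,b}C^{abc}_{lmn}\phi^a_l\psi^b_m$ and a difference operator $(D\phi)^c_n=\sum_m\sum_a D^{ac}_{mn}\phi^a_m$; (3) and (4) are the coefficient forms of $D(\phi\cdot\psi)=(D\phi)\cdot\psi+\phi\cdot(D\psi)$ and $(\phi\cdot\psi)\cdot\chi=\phi\cdot(\psi\cdot\chi)$. Under the identification of a matrix $\Phi_{ij}$ with $\phi^a_n$, where $a=i-j$ and $n=i+j$, the product rule is matrix multiplication and $D$ is the commutator $[d,\Phi]$ with the matrix $d_{ij}=\tilde d(j-i)$. *)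

theory Defs
  imports "HOL-Complex_Analysis.Complex_Analysis" "HOL-Library.Groups_Big_Fun"
begin

definition kdelta :: "int \<Rightarrow> int \<Rightarrow> complex"
  where "kdelta x y = (if x = y then 1 else 0)"

text \<open>Argument order: the upper (flavor) indices come first, then the lower (site) indices.\<close>

definition Ccoef :: "int \<Rightarrow> int \<Rightarrow> int \<Rightarrow> int \<Rightarrow> int \<Rightarrow> int \<Rightarrow> complex"
  where "Ccoef a b c l m n = kdelta (l - n) b * kdelta (n - m) a * kdelta c (a + b)"

definition Dcoef :: "(int \<Rightarrow> complex) \<Rightarrow> int \<Rightarrow> int \<Rightarrow> int \<Rightarrow> int \<Rightarrow> complex"
  where "Dcoef dt a c m n =
    dt (a - c) * (kdelta (m - n) (a - c) - kdelta (m - n) (- a + c))"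

text \<open>Sums over the integers with finitely many nonzero terms are rendered by \<^const>\<open>Sum_any\<close>,
  which is 0 when the support is infinite; finiteness of the supports has to be stated separately.\<close>

definition Chat :: "int \<Rightarrow> int \<Rightarrow> int \<Rightarrow> complex \<Rightarrow> complex \<Rightarrow> complex"
  where "Chat a b c v w =
    Sum_any (\<lambda>(k, l). Ccoef a b c k l 0 * v powi k * w powi l)"

definition Dhat :: "(int \<Rightarrow> complex) \<Rightarrow> int \<Rightarrow> int \<Rightarrow> complex \<Rightarrow> complex"
  where "Dhat dt a c v = Sum_any (\<lambda>m. Dcoef dt a c m 0 * v powi m)"

definition annulus :: "real \<Rightarrow> real \<Rightarrow> complex set"
  where "annulus r R = {z. r < norm z \<and> norm z < R}"

text \<open>Joint holomorphy in two variables: at every point there is a complex-linear Frechet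
  derivative. As for \<^const>\<open>holomorphic_on\<close>, this is the usual notion when \<open>S\<close> is open.\<close>

definition holomorphic2_on :: "(complex \<times> complex \<Rightarrow> complex) \<Rightarrow> (complex \<times> complex) set \<Rightarrow> bool"
  where "holomorphic2_on f S \<longleftrightarrow>
    (\<forall>p\<in>S. \<exists>\<alpha> \<beta>. (f has_derivative (\<lambda>(x, y). \<alpha> * x + \<beta> * y)) (at p within S))"

end

(* The delta factors of C determine the summation variables, so in (3) and (4) every double sum
   consists of a single term. In the Leibniz rule the negative term of the first sum on the right
   cancels the positive term of the second one, as the cross terms of [d, Phi Psi] do. *)

theory Submission
  imports Defs
begin

lemma Sum_any_single:
  assumes "\<And>x. x \<noteq> x0 \<Longrightarrow> f x = 0"
  shows "Sum_any f = f x0"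
proof -
  have "Sum_any f = sum f {x0}"
    using assms by (intro Sum_any.expand_superset) auto
  then show ?thesis by simp
qed

lemma Sum_any_Sum_any_single:
  assumes "\<And>x y. x \<noteq> x0 \<or> y \<noteq> y0 \<Longrightarrow> f x y = 0"
  shows "Sum_any (\<lambda>x. Sum_any (\<lambda>y. f x y)) = f x0 y0"
proof -
  have "Sum_any (\<lambda>x. Sum_any (\<lambda>y. f x y)) = Sum_any (\<lambda>y. f x0 y)"
    using assms by (intro Sum_any_single) simp
  also have "\<dots> = f x0 y0"
    using assms by (intro Sum_any_single) simp
  finally show ?thesis .
qed

text \<open>\<open>Sum_any\<close> returns 0 on an infinite support, so an identity between such
  sums has its intended meaning only together with finiteness. Here at most one point carries a
  nonzero value.\<close>

lemma finite_support_single: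
  assumes "\<And>x y. x \<noteq> x0 \<or> y \<noteq> y0 \<Longrightarrow> f x y = 0"
  shows "finite {(x, y). f x y \<noteq> 0}"
  by (rule finite_subset[of _ "{(x0, y0)}"]) (use assms in auto)

text \<open>Putting \<open>a = i - j\<close>, \<open>l = i + j\<close>, \<open>b = j - k\<close>,
  \<open>m = j + k\<close>, \<open>c = i - k\<close>, \<open>n = i + k\<close> satisfies the three
  conditions: entries \<open>(i, j)\<close> and \<open>(j, k)\<close> contribute to entry
  \<open>(i, k)\<close> of a matrix product. As one conditional they are linear integer constraints,
  open to case splitting.\<close>

lemma Ccoef_eq:
  "Ccoef a b c l m n = (if l - n = b \<and> n - m = a \<and> c = a + b then 1 else 0)"
  by (simp add: Ccoef_def kdelta_def)

lemma Ccoef_translation: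
  assumes "l - n = l' - n'" "m - n = m' - n'"
  shows "Ccoef a b c l m n = Ccoef a b c l' m' n'"
proof -
  \<comment> \<open>The second delta of C contains the negative of the difference in the
    hypothesis.\<close>
  have "n - m = n' - m'" using assms by simp
  with assms show ?thesis by (simp only: Ccoef_def)
qed

lemma Dcoef_translation:
  "m - n = m' - n' \<Longrightarrow> Dcoef dt a c m n = Dcoef dt a c m' n'"
  by (simp add: Dcoef_def)

lemma finite_Ccoef_support: "finite {(k, l). Ccoef a b c k l 0 \<noteq> 0}"
  by (rule finite_support_single[of b "- a"]) (auto simp: Ccoef_eq)

lemma Chat_eq: "Chat a b c v w = kdelta (a + b) c * v powi b * w powi (- a)"
proof -
  \<comment> \<open>At target site 0 the first two deltas force \<open>k = b\<close> and
    \<open>l = - a\<close>; the third survives as the constant factor.\<close>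
  have "Chat a b c v w = (\<lambda>(k, l). Ccoef a b c k l 0 * v powi k * w powi l) (b, - a)"
    unfolding Chat_def by (rule Sum_any_single) (auto simp: Ccoef_eq split: if_splits)
  then show ?thesis by (auto simp: Ccoef_eq kdelta_def)
qed

text \<open>Only an inclusion: for \<open>a = c\<close> the two deltas cancel, and
  \<open>dt (a - c)\<close> may be 0.\<close>

lemma Dcoef_support: "{m. Dcoef dt a c m 0 \<noteq> 0} \<subseteq> {a - c, - a + c}"
  by (auto simp: Dcoef_def kdelta_def split: if_splits)

lemma finite_Dcoef_support: "finite {m. Dcoef dt a c m 0 \<noteq> 0}"
  by (rule finite_subset[OF Dcoef_support]) simp

lemma Dhat_eq: "Dhat dt a c v = dt (a - c) * (v powi (a - c) - v powi (- a + c))"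
proof -
  have "Dhat dt a c v = (\<Sum>m\<in>{a - c, - a + c}. Dcoef dt a c m 0 * v powi m)"
    unfolding Dhat_def using Dcoef_support[of dt a c]
    by (intro Sum_any.expand_superset) auto
  \<comment> \<open>For \<open>a = c\<close> the two summation points coincide and both sides
    vanish; otherwise the points are distinct and each gives one term.\<close>
  then show ?thesis
    by (cases "a = c") (auto simp: Dcoef_def kdelta_def algebra_simps)
qed

text \<open>Composing each factor with its projection turns the claim into the product rule for
  Frechet derivatives.\<close>

lemma holomorphic2_on_mult:
  assumes "g holomorphic_on S" "h holomorphic_on T"
  shows "holomorphic2_on (\<lambda>(v, w). g v * h w) (S \<times> T)"
  unfolding holomorphic2_on_def
proof
  fix p assume "p \<in> S \<times> T"
  then obtain v w where p: "p = (v, w)" "v \<in> S" "w \<in> T" by auto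
  from assms p obtain g' h' where
    g': "(g has_field_derivative g') (at v within S)" and
    h': "(h has_field_derivative h') (at w within T)"
    by (metis field_differentiable_def holomorphic_on_def)
  have 1: "((\<lambda>q. g (fst q)) has_derivative (\<lambda>q. g' * fst q)) (at p within S \<times> T)"
  proof (rule has_derivative_in_compose[where g = g and g' = "(*) g'" and f = fst and f' = fst])
    have "fst ` (S \<times> T) \<subseteq> S" by auto
    then show "(g has_derivative (*) g') (at (fst p) within fst ` (S \<times> T))"
      using g' p by (auto simp: has_field_derivative_def intro: has_derivative_subset)
  qed (auto intro!: derivative_eq_intros)
  have 2: "((\<lambda>q. h (snd q)) has_derivative (\<lambda>q. h' * snd q)) (at p within S \<times> T)"
  proof (rule has_derivative_in_compose[where g = h and g' = "(*) h'" and f = snd and f' = snd])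
    have "snd ` (S \<times> T) \<subseteq> T" by auto
    then show "(h has_derivative (*) h') (at (snd p) within snd ` (S \<times> T))"
      using h' p by (auto simp: has_field_derivative_def intro: has_derivative_subset)
  qed (auto intro!: derivative_eq_intros)
  show "\<exists>\<alpha> \<beta>. ((\<lambda>(v, w). g v * h w) has_derivative (\<lambda>(x, y). \<alpha> * x + \<beta> * y))
      (at p within S \<times> T)"
    \<comment> \<open>The witnesses are the two partial derivatives of the product.\<close>
    using has_derivative_mult[OF 1 2] p
    by (intro exI[of _ "g' * h w"] exI[of _ "g v * h'"])
       (auto simp: case_prod_unfold algebra_simps)
qed

text \<open>The only possible pole is the origin, which \<open>0 < r\<close> keeps out of the
  annulus.\<close>

lemma powi_holomorphic_on_annulus:
  "0 < r \<Longrightarrow> (\<lambda>z. z powi n) holomorphic_on annulus r R"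
  by (intro holomorphic_intros) (auto simp: annulus_def)

text \<open>The closed form separates into a monomial in \<open>v\<close>, which absorbs the
  constant delta, times a monomial in \<open>w\<close>.\<close>

lemma Chat_holomorphic2:
  assumes "0 < r"
  shows "holomorphic2_on (\<lambda>(v, w). Chat a b c v w) (annulus r R \<times> annulus r R)"
  unfolding Chat_eq using assms
  by (intro holomorphic2_on_mult holomorphic_intros powi_holomorphic_on_annulus)

lemma Chat_holomorphic_left:
  "0 < r \<Longrightarrow> (\<lambda>v. Chat a b c v w) holomorphic_on annulus r R"
  unfolding Chat_eq by (intro holomorphic_intros powi_holomorphic_on_annulus)

lemma Chat_holomorphic_right:
  "0 < r \<Longrightarrow> (\<lambda>w. Chat a b c v w) holomorphic_on annulus r R"
  unfolding Chat_eq by (intro holomorphic_intros powi_holomorphic_on_annulus)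

lemma Dhat_holomorphic:
  "0 < r \<Longrightarrow> Dhat dt a c holomorphic_on annulus r R"
  unfolding Dhat_eq[abs_def] by (intro holomorphic_intros powi_holomorphic_on_annulus)

text \<open>In each product two deltas of C already fix \<open>k\<close> and \<open>d\<close>; the
  same points evaluate the sums in the Leibniz rule.\<close>

lemma finite_Leibniz_supports:
  "finite {(k, d). Ccoef a b d l m k * Dcoef dt d c k n \<noteq> 0}"
  "finite {(k, d). Ccoef d b c k m n * Dcoef dt a d l k \<noteq> 0}"
  "finite {(k, d). Ccoef a d c l k n * Dcoef dt b d m k \<noteq> 0}"
  subgoal by (rule finite_support_single[of "l - b" "a + b"]) (auto simp: Ccoef_eq)
  subgoal by (rule finite_support_single[of "n + b" "c - b"]) (auto simp: Ccoef_eq)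
  subgoal by (rule finite_support_single[of "n - a" "c - a"]) (auto simp: Ccoef_eq)
  done

lemma Leibniz_rule:
  "Sum_any (\<lambda>k. Sum_any (\<lambda>d. Ccoef a b d l m k * Dcoef dt d c k n)) =
     Sum_any (\<lambda>k. Sum_any (\<lambda>d. Ccoef d b c k m n * Dcoef dt a d l k)) +
     Sum_any (\<lambda>k. Sum_any (\<lambda>d. Ccoef a d c l k n * Dcoef dt b d m k))"
  (is "?L = ?R1 + ?R2")
proof -
  have L: "?L = Ccoef a b (a + b) l m (l - b) * Dcoef dt (a + b) c (l - b) n"
    by (rule Sum_any_Sum_any_single) (auto simp: Ccoef_eq)
  have R1: "?R1 = Ccoef (c - b) b c (n + b) m n * Dcoef dt a (c - b) l (n + b)"
    by (rule Sum_any_Sum_any_single) (auto simp: Ccoef_eq)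
  have R2: "?R2 = Ccoef a (c - a) c l (n - a) n * Dcoef dt b (c - a) m (n - a)"
    by (rule Sum_any_Sum_any_single) (auto simp: Ccoef_eq)
  \<comment> \<open>All three flavor differences equal \<open>a + b - c\<close>, so the arbitrary
    function enters only through one common factor.\<close>
  define t where "t = dt (a + b - c)"
  have t: "dt (a - (c - b)) = t" "dt (b - (c - a)) = t"
    by (simp_all add: t_def algebra_simps)
  \<comment> \<open>The positive terms of \<open>?L\<close> and \<open>?R1\<close> agree, as do the
    negative terms of \<open>?L\<close> and \<open>?R2\<close>. The two cross terms both live on
    \<open>n - m = c - b\<close>, \<open>l - n = c - a\<close>.\<close>
  show ?thesis
    unfolding L R1 R2 unfolding Dcoef_def t t_def[symmetric] by (auto simp: Ccoef_eq kdelta_def)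
qed

lemma finite_associative_supports:
  "finite {(j, d). Ccoef a b d l m j * Ccoef d c e j n k \<noteq> 0}"
  "finite {(j, d). Ccoef a d e l j k * Ccoef b c d m n j \<noteq> 0}"
  subgoal by (rule finite_support_single[of "l - b" "a + b"]) (auto simp: Ccoef_eq)
  subgoal by (rule finite_support_single[of "k - a" "b + c"]) (auto simp: Ccoef_eq)
  done

lemma associative_law:
  "Sum_any (\<lambda>j. Sum_any (\<lambda>d. Ccoef a b d l m j * Ccoef d c e j n k)) =
     Sum_any (\<lambda>j. Sum_any (\<lambda>d. Ccoef a d e l j k * Ccoef b c d m n j))"
  (is "?L = ?R")
proof -
  have L: "?L = Ccoef a b (a + b) l m (l - b) * Ccoef (a + b) c e (l - b) n k"
    by (rule Sum_any_Sum_any_single) (auto simp: Ccoef_eq)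
  have R: "?R = Ccoef a (b + c) e l (k - a) k * Ccoef b c (b + c) m n (k - a)"
    by (rule Sum_any_Sum_any_single) (auto simp: Ccoef_eq)
  \<comment> \<open>Both products are 1 exactly when \<open>l - m = a + b\<close>,
    \<open>l - k = b + c\<close>, \<open>k - n = a + b\<close> and
    \<open>e = a + b + c\<close>.\<close>
  show ?thesis
    unfolding L R by (auto simp: Ccoef_eq)
qed

theorem mainTheorem5:
  fixes dt :: "int \<Rightarrow> complex"
  shows
    "(\<forall>a b c l m n l' m' n'. l - n = l' - n' \<longrightarrow> m - n = m' - n' \<longrightarrow>
        Ccoef a b c l m n = Ccoef a b c l' m' n') \<and>
     (\<forall>a c m n m' n'. m - n = m' - n' \<longrightarrow> Dcoef dt a c m n = Dcoef dt a c m' n') \<and>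
     (\<forall>a b c. finite {(k, l). Ccoef a b c k l 0 \<noteq> 0} \<and>
        (\<forall>v w. v \<noteq> 0 \<longrightarrow> w \<noteq> 0 \<longrightarrow>
          Chat a b c v w = kdelta (a + b) c * v powi b * w powi (- a)) \<and>
        (\<exists>r R. 0 < r \<and> r < 1 \<and> 1 < R \<and>
          holomorphic2_on (\<lambda>(v, w). Chat a b c v w) (annulus r R \<times> annulus r R) \<and>
          (\<forall>w\<in>annulus r R. (\<lambda>v. Chat a b c v w) holomorphic_on annulus r R) \<and>
          (\<forall>v\<in>annulus r R. (\<lambda>w. Chat a b c v w) holomorphic_on annulus r R))) \<and>
     (\<forall>a c. finite {m. Dcoef dt a c m 0 \<noteq> 0} \<and>
        (\<forall>v. v \<noteq> 0 \<longrightarrow>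
          Dhat dt a c v = dt (a - c) * (v powi (a - c) - v powi (- a + c))) \<and>
        (\<exists>r R. 0 < r \<and> r < 1 \<and> 1 < R \<and> Dhat dt a c holomorphic_on annulus r R)) \<and>
     (\<forall>a b c l m n.
       finite {(k, d). Ccoef a b d l m k * Dcoef dt d c k n \<noteq> 0} \<and>
       finite {(k, d). Ccoef d b c k m n * Dcoef dt a d l k \<noteq> 0} \<and>
       finite {(k, d). Ccoef a d c l k n * Dcoef dt b d m k \<noteq> 0} \<and>
       Sum_any (\<lambda>k. Sum_any (\<lambda>d. Ccoef a b d l m k * Dcoef dt d c k n)) =
         Sum_any (\<lambda>k. Sum_any (\<lambda>d. Ccoef d b c k m n * Dcoef dt a d l k)) +
         Sum_any (\<lambda>k. Sum_any (\<lambda>d. Ccoef a d c l k n * Dcoef dt b d m k))) \<and>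
     (\<forall>a b c e l m n k.
       finite {(j, d). Ccoef a b d l m j * Ccoef d c e j n k \<noteq> 0} \<and>
       finite {(j, d). Ccoef a d e l j k * Ccoef b c d m n j \<noteq> 0} \<and>
       Sum_any (\<lambda>j. Sum_any (\<lambda>d. Ccoef a b d l m j * Ccoef d c e j n k)) =
         Sum_any (\<lambda>j. Sum_any (\<lambda>d. Ccoef a d e l j k * Ccoef b c d m n j)))"
proof (intro conjI allI impI)
  fix a b c
  show "\<exists>r R. 0 < r \<and> r < 1 \<and> 1 < R \<and>
      holomorphic2_on (\<lambda>(v, w). Chat a b c v w) (annulus r R \<times> annulus r R) \<and>
      (\<forall>w\<in>annulus r R. (\<lambda>v. Chat a b c v w) holomorphic_on annulus r R) \<and>
      (\<forall>v\<in>annulus r R. (\<lambda>w. Chat a b c v w) holomorphic_on annulus r R)"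
    \<comment> \<open>Any radii \<open>0 < r < 1 < R\<close> would do, since the monomials are
      holomorphic away from 0.\<close>
    by (intro exI[of _ "1/2"] exI[of _ 2] conjI ballI Chat_holomorphic2
        Chat_holomorphic_left Chat_holomorphic_right) simp_all
next
  fix a c
  show "\<exists>r R. 0 < r \<and> r < 1 \<and> 1 < R \<and> Dhat dt a c holomorphic_on annulus r R"
    by (intro exI[of _ "1/2"] exI[of _ 2] conjI Dhat_holomorphic) simp_all
qed (rule Ccoef_translation Dcoef_translation Chat_eq Dhat_eq finite_Ccoef_support
      finite_Dcoef_support finite_Leibniz_supports Leibniz_rule finite_associative_supports
      associative_law; assumption)+

end
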